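(* Let $G$ be a graph and let $M$ be a lift of the cycle matroid $M(G)$. Then $G$ is a framework for $M$. Moreover, if $C_1$ and $C_2$ are vertex-disjoint cycles of $G$, then $E(C_1\cup C_2)$ is dependent in $M$.
   Context: A matroid $M$ is a lift of a matroid $N$ if there is a matroid $M'$ and an element $e\in E(M')$ with $M'\setminus e=M$ and $M'/e=N$. For a graph $G$ and a vertex $v$, $\mathrm{loops}_G(v)$ denotes the set of loop-edges of $G$ at $v$. Graphs are finite and may have loops and parallel edges (a loop-edge is a cycle of length one). For a set $X$ of edges, $G[X]$ is the subgraph of $G$ with edge-set $X$ and no isolated vertices. A graph $G$ is a framework for a matroid $M$ if (1) $E(G)=E(M)$; (2) $r_M(E(H))\le |V(H)|$ for each component $H$ of $G$; (3) for each vertex $v$ of $G$, $\mathrm{cl}_M(E(G-v))\subseteq E(G-v)\cup \mathrm{loops}_G(v)$; and (4) for each circuit $C$ of $M$, the subgraph $G[C]$ has at most two components. *)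

theory Defs
  imports Main
begin

section \<open>Finite matroids\<close>

record 'a matroid =
  ground :: "'a set"
  indeps :: "'a set set"

definition is_matroid :: "'a matroid \<Rightarrow> bool" where
  "is_matroid M \<longleftrightarrow>
     finite (ground M) \<and>
     (\<forall>X\<in>indeps M. X \<subseteq> ground M) \<and>
     {} \<in> indeps M \<and>
     (\<forall>X Y. X \<in> indeps M \<and> Y \<subseteq> X \<longrightarrow> Y \<in> indeps M) \<and>
     (\<forall>X Y. X \<in> indeps M \<and> Y \<in> indeps M \<and> card X < card Y \<longrightarrow>
        (\<exists>y\<in>Y - X. insert y X \<in> indeps M))"

definition dependent_in :: "'a matroid \<Rightarrow> 'a set \<Rightarrow> bool" where
  "dependent_in M X \<longleftrightarrow> X \<subseteq> ground M \<and> X \<notin> indeps M"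

definition circuit :: "'a matroid \<Rightarrow> 'a set \<Rightarrow> bool" where
  "circuit M C \<longleftrightarrow> dependent_in M C \<and> (\<forall>D. D \<subset> C \<longrightarrow> \<not> dependent_in M D)"

definition basis_of :: "'a matroid \<Rightarrow> 'a set \<Rightarrow> 'a set \<Rightarrow> bool" where
  "basis_of M X B \<longleftrightarrow>
     B \<subseteq> X \<and> B \<in> indeps M \<and> (\<forall>B'. B \<subseteq> B' \<and> B' \<subseteq> X \<and> B' \<in> indeps M \<longrightarrow> B' = B)"

definition matroid_rank :: "'a matroid \<Rightarrow> 'a set \<Rightarrow> nat" where
  "matroid_rank M X = Max (card ` {Y \<in> indeps M. Y \<subseteq> X})"

definition matroid_closure :: "'a matroid \<Rightarrow> 'a set \<Rightarrow> 'a set" where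
  "matroid_closure M X = {x \<in> ground M. matroid_rank M (insert x X) = matroid_rank M X}"

definition delete_elem :: "'a matroid \<Rightarrow> 'a \<Rightarrow> 'a matroid" where
  "delete_elem M e = \<lparr>ground = ground M - {e}, indeps = {X \<in> indeps M. e \<notin> X}\<rparr>"

text \<open>The basis \<open>B\<close> of \<open>{e}\<close> is \<open>{e}\<close>, or empty if \<open>e\<close> is a loop of the matroid; in the
  latter case contraction and deletion of \<open>e\<close> agree.\<close>

definition contract_elem :: "'a matroid \<Rightarrow> 'a \<Rightarrow> 'a matroid" where
  "contract_elem M e =
     \<lparr>ground = ground M - {e},
      indeps = {X. X \<subseteq> ground M - {e} \<and> (\<exists>B. basis_of M {e} B \<and> X \<union> B \<in> indeps M)}\<rparr>"

definition relabel :: "('a \<Rightarrow> 'b) \<Rightarrow> 'a matroid \<Rightarrow> 'b matroid" where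
  "relabel f M = \<lparr>ground = f ` ground M, indeps = (\<lambda>X. f ` X) ` indeps M\<rparr>"

text \<open>The matroid \<open>M'\<close> has one element more than \<open>M\<close>, and the type \<open>'a\<close> may have no element
  outside \<open>ground M\<close>. So \<open>M'\<close> lives on \<open>'a option\<close>, into which \<open>M\<close> and \<open>N\<close> are copied along
  the injection \<open>Some\<close>; any other choice of the new element gives an isomorphic \<open>M'\<close>.\<close>

definition lift_of :: "'a matroid \<Rightarrow> 'a matroid \<Rightarrow> bool" where
  "lift_of M N \<longleftrightarrow>
     (\<exists>(M' :: 'a option matroid) e. is_matroid M' \<and> e \<in> ground M' \<and>
        delete_elem M' e = relabel Some M \<and> contract_elem M' e = relabel Some N)"


section \<open>Finite graphs with loops and parallel edges\<close>

text \<open>The set \<open>ends G e\<close> is a singleton exactly when \<open>e\<close> is a loop-edge.\<close>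

record ('v, 'e) multigraph =
  vertices :: "'v set"
  edges :: "'e set"
  ends :: "'e \<Rightarrow> 'v set"

definition finite_graph :: "('v, 'e) multigraph \<Rightarrow> bool" where
  "finite_graph G \<longleftrightarrow>
     finite (vertices G) \<and> finite (edges G) \<and>
     (\<forall>e\<in>edges G. ends G e \<subseteq> vertices G \<and> (card (ends G e) = 1 \<or> card (ends G e) = 2))"

text \<open>A subgraph keeps the whole function \<open>ends\<close>, also on non-edges, so that it is determined by
  its vertices and edges and components are counted correctly.\<close>

definition is_subgraph :: "('v, 'e) multigraph \<Rightarrow> ('v, 'e) multigraph \<Rightarrow> bool" where
  "is_subgraph H G \<longleftrightarrow>
     vertices H \<subseteq> vertices G \<and> edges H \<subseteq> edges G \<and> ends H = ends G \<and>
     (\<forall>e\<in>edges H. ends H e \<subseteq> vertices H)"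

definition adjacency :: "('v, 'e) multigraph \<Rightarrow> ('v \<times> 'v) set" where
  "adjacency G = {(u, v). \<exists>e\<in>edges G. ends G e = {u, v}}"

definition connected_graph :: "('v, 'e) multigraph \<Rightarrow> bool" where
  "connected_graph G \<longleftrightarrow>
     vertices G \<noteq> {} \<and> (\<forall>u\<in>vertices G. \<forall>v\<in>vertices G. (u, v) \<in> (adjacency G)\<^sup>*)"

definition components :: "('v, 'e) multigraph \<Rightarrow> ('v, 'e) multigraph set" where
  "components G =
     {H. is_subgraph H G \<and> connected_graph H \<and>
         (\<forall>K. is_subgraph K G \<and> connected_graph K \<and> is_subgraph H K \<longrightarrow> K = H)}"

definition delete_vertex :: "('v, 'e) multigraph \<Rightarrow> 'v \<Rightarrow> ('v, 'e) multigraph" where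
  "delete_vertex G v =
     \<lparr>vertices = vertices G - {v}, edges = {e \<in> edges G. v \<notin> ends G e}, ends = ends G\<rparr>"

definition loops_at :: "('v, 'e) multigraph \<Rightarrow> 'v \<Rightarrow> 'e set" where
  "loops_at G v = {e \<in> edges G. ends G e = {v}}"

definition edge_subgraph :: "('v, 'e) multigraph \<Rightarrow> 'e set \<Rightarrow> ('v, 'e) multigraph" where
  "edge_subgraph G X = \<lparr>vertices = (\<Union>e\<in>X. ends G e), edges = X, ends = ends G\<rparr>"

definition graph_union ::
    "('v, 'e) multigraph \<Rightarrow> ('v, 'e) multigraph \<Rightarrow> ('v, 'e) multigraph" where
  "graph_union H K =
     \<lparr>vertices = vertices H \<union> vertices K, edges = edges H \<union> edges K, ends = ends H\<rparr>"

text \<open>A cycle of length \<open>1\<close> is a loop-edge with its vertex; a cycle of length \<open>2\<close> is a pair of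
  parallel edges, whence the requirement that \<open>es\<close> be distinct.\<close>

definition is_cycle :: "('v, 'e) multigraph \<Rightarrow> ('v, 'e) multigraph \<Rightarrow> bool" where
  "is_cycle G C \<longleftrightarrow> is_subgraph C G \<and>
     (\<exists>vs es. es \<noteq> [] \<and> length vs = length es \<and> distinct vs \<and> distinct es \<and>
        vertices C = set vs \<and> edges C = set es \<and>
        (\<forall>i<length es. ends C (es ! i) = {vs ! i, vs ! (Suc i mod length es)}))"

definition cycle_matroid :: "('v, 'e) multigraph \<Rightarrow> 'e matroid" where
  "cycle_matroid G =
     \<lparr>ground = edges G, indeps = {X. X \<subseteq> edges G \<and> \<not> (\<exists>C. is_cycle G C \<and> edges C \<subseteq> X)}\<rparr>"


section \<open>Frameworks\<close>

definition is_framework :: "('v, 'e) multigraph \<Rightarrow> 'e matroid \<Rightarrow> bool" where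
  "is_framework G M \<longleftrightarrow>
     edges G = ground M \<and>
     (\<forall>H\<in>components G. matroid_rank M (edges H) \<le> card (vertices H)) \<and>
     (\<forall>v\<in>vertices G. matroid_closure M (edges (delete_vertex G v))
                       \<subseteq> edges (delete_vertex G v) \<union> loops_at G v) \<and>
     (\<forall>C. circuit M C \<longrightarrow> card (components (edge_subgraph G C)) \<le> 2)"

end

theory Submission
  imports Defs
begin

text \<open>Let \<open>M = M' \<setminus> f\<close> and \<open>N = M' / f\<close>. Two facts about single-element lifts carry the proof: an
  independent set of \<open>M\<close> becomes independent in \<open>N\<close> after removing a suitable element, and an
  element that is independent of all of \<open>I\<close> in \<open>N\<close> is independent of it in \<open>M\<close>. The first
  gives the dependence of two disjoint cycles, and, together with the fact that a forest has fewer
  edges than vertices, the rank bound. The second gives the closure axiom, since a non-loop edge at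
  \<open>v\<close> lies in no cycle whose other edges avoid \<open>v\<close>; it also shows that every edge of a circuit
  \<open>C\<close> of \<open>M\<close> lies in a cycle of \<open>G[C]\<close>. Hence each component of \<open>G[C]\<close> contains a cycle, and with
  three components, two of these cycles would form a dependent proper subset of \<open>C\<close>.\<close>

section \<open>Single-element lifts\<close>

lemma finite_indep: "is_matroid M \<Longrightarrow> X \<in> indeps M \<Longrightarrow> finite X"
  unfolding is_matroid_def by (meson finite_subset)

lemma indep_subset_ground: "is_matroid M \<Longrightarrow> X \<in> indeps M \<Longrightarrow> X \<subseteq> ground M"
  unfolding is_matroid_def by blast

lemma indep_empty: "is_matroid M \<Longrightarrow> {} \<in> indeps M"
  unfolding is_matroid_def by blast

lemma indep_mono: "is_matroid M \<Longrightarrow> X \<in> indeps M \<Longrightarrow> Y \<subseteq> X \<Longrightarrow> Y \<in> indeps M"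
  unfolding is_matroid_def by blast

lemma indep_augment:
  assumes "is_matroid M" "X \<in> indeps M" "Y \<in> indeps M" "card X < card Y"
  obtains y where "y \<in> Y - X" "insert y X \<in> indeps M"
proof -
  have "\<forall>X Y. X \<in> indeps M \<and> Y \<in> indeps M \<and> card X < card Y \<longrightarrow>
      (\<exists>y\<in>Y - X. insert y X \<in> indeps M)"
    using assms(1) by (simp add: is_matroid_def)
  then show ?thesis using assms(2-4) that by blast
qed

lemma basis_of_singleton:
  assumes "is_matroid M"
  shows "basis_of M {f} B \<longleftrightarrow> B = (if {f} \<in> indeps M then {f} else {})"
  using indep_empty[OF assms] unfolding basis_of_def by (auto simp: subset_singleton_iff)

lemma indep_contract_iff:
  assumes "is_matroid M"
  shows "X \<in> indeps (contract_elem M f) \<longleftrightarrow>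
    f \<notin> X \<and> (if {f} \<in> indeps M then insert f X \<in> indeps M else X \<in> indeps M)"
  using indep_subset_ground[OF assms]
  by (auto simp: contract_elem_def basis_of_singleton[OF assms])

text \<open>Take a largest \<open>J\<close> inside \<open>A\<close> whose union with
  \<open>f\<close> is independent; \<open>{}\<close> is a candidate because \<open>f\<close> is not
  a loop of the matroid. If \<open>insert f J\<close> were smaller than \<open>A\<close>,
  augmentation would add another element of \<open>A\<close> to \<open>J\<close>. So making room for
  \<open>f\<close> costs \<open>A\<close> at most one element.\<close>

lemma exchange_into_indep:
  assumes M: "is_matroid M" and A: "A \<in> indeps M" and f: "{f} \<in> indeps M" "f \<notin> A"
  obtains J where "J \<subseteq> A" "insert f J \<in> indeps M" "card A \<le> Suc (card J)"
proof -
  define S where "S = {J. J \<subseteq> A \<and> insert f J \<in> indeps M}"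
  have finA: "finite A" using finite_indep[OF M A] .
  have fin: "finite S" using finA unfolding S_def by simp
  have ne: "S \<noteq> {}" using f unfolding S_def by auto
  obtain J where J: "J \<in> S" and max: "\<And>K. K \<in> S \<Longrightarrow> card K \<le> card J"
  proof -
    have "Max (card ` S) \<in> card ` S" using fin ne by (intro Max_in) auto
    then obtain J where J: "J \<in> S" "Max (card ` S) = card J" by blast
    have "card K \<le> card J" if "K \<in> S" for K
      unfolding J(2)[symmetric] using fin that by (intro Max_ge) auto
    then show ?thesis using that J(1) by blast
  qed
  have finJ: "finite J" and fJ: "f \<notin> J" using J finA f unfolding S_def by (auto intro: finite_subset)
  have "card A \<le> Suc (card J)"
  proof (rule ccontr)
    assume "\<not> ?thesis"
    then have "card (insert f J) < card A" using finJ fJ by simp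
    then obtain y where y: "y \<in> A - insert f J" "insert y (insert f J) \<in> indeps M"
      using indep_augment[OF M _ A] J unfolding S_def by blast
    then have "insert y J \<in> S" using J unfolding S_def by (auto simp: insert_commute)
    from max[OF this] y finJ show False by auto
  qed
  then show ?thesis using J that unfolding S_def by blast
qed

text \<open>If \<open>f\<close> is not a loop, independence of a set in the contraction means
  independence together with \<open>f\<close>, and the exchange above drops at most one element. If
  \<open>f\<close> is a loop, contraction and deletion agree and any \<open>x\<close> will do.
  Removing an \<open>x\<close> outside \<open>X\<close> covers the case where nothing has to
  go.\<close>

lemma delete_indep_almost_contract_indep:
  assumes M: "is_matroid M" and X: "X \<in> indeps (delete_elem M f)"
  shows "\<exists>x. X - {x} \<in> indeps (contract_elem M f)"
proof (cases "{f} \<in> indeps M")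
  case True
  have X': "X \<in> indeps M" "f \<notin> X" using X by (auto simp: delete_elem_def)
  obtain J where J: "J \<subseteq> X" "insert f J \<in> indeps M" "card X \<le> Suc (card J)"
    using exchange_into_indep[OF M X'(1) True X'(2)] .
  have fin: "finite X" using finite_indep[OF M X'(1)] .
  have "card (X - J) \<le> 1" using J fin by (simp add: card_Diff_subset finite_subset)
  then obtain x where "X - J \<subseteq> {x}"
    using fin by (metis card_le_Suc0_iff_eq One_nat_def finite_Diff singletonI subsetI)
  then have "X - {x} \<subseteq> J" by blast
  then have "insert f (X - {x}) \<in> indeps M" using indep_mono[OF M J(2)] by blast
  then show ?thesis using True X' by (auto simp: indep_contract_iff[OF M])
next
  case False
  have "X - {x} \<in> indeps M" "f \<notin> X - {x}" for x
    using X indep_mono[OF M] by (auto simp: delete_elem_def)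
  then show ?thesis using False by (auto simp: indep_contract_iff[OF M])
qed

text \<open>The hypothesis \<open>ext\<close> is used twice: once for a nearly full subset
  \<open>J\<close> of \<open>I\<close>, to get an independent set larger than \<open>I\<close>, and
  once for \<open>I\<close> itself, after augmentation has shown that \<open>insert f I\<close> is
  independent.\<close>

lemma delete_insert_indep:
  assumes M: "is_matroid M" and I: "I \<in> indeps (delete_elem M f)"
    and ext: "\<And>J. J \<subseteq> I \<Longrightarrow> J \<in> indeps (contract_elem M f)
      \<Longrightarrow> insert x J \<in> indeps (contract_elem M f)"
  shows "insert x I \<in> indeps (delete_elem M f)"
proof -
  have I': "I \<in> indeps M" "f \<notin> I" using I by (auto simp: delete_elem_def)
  have fin: "finite I" using finite_indep[OF M I'(1)] .
  show ?thesis
  proof (cases "{f} \<in> indeps M")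
    case True
    have ext': "insert x (insert f J) \<in> indeps M \<and> x \<noteq> f"
      if "J \<subseteq> I" "insert f J \<in> indeps M" for J
      using ext[of J] that I' True by (auto simp: indep_contract_iff[OF M] insert_commute)
    obtain J where J: "J \<subseteq> I" "insert f J \<in> indeps M" "card I \<le> Suc (card J)"
      using exchange_into_indep[OF M I'(1) True I'(2)] .
    have "insert x I \<in> indeps M"
    proof (rule ccontr)
      assume dep: "insert x I \<notin> indeps M"
      then have "x \<notin> I" using I' by (auto simp: insert_absorb)
      have xf: "insert x (insert f J) \<in> indeps M" "x \<noteq> f" using ext'[OF J(1,2)] by auto
      have "x \<notin> insert f J" "f \<notin> J" "finite J"
        using \<open>x \<notin> I\<close> J(1) fin I'(2) xf(2) finite_subset by auto
      then have "card (insert x (insert f J)) = Suc (Suc (card J))" by simp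
      then have "card I < card (insert x (insert f J))" using J by simp
      then obtain y where y: "y \<in> insert x (insert f J) - I" "insert y I \<in> indeps M"
        using indep_augment[OF M I'(1) xf(1)] by blast
      \<comment> \<open>The new element \<open>y\<close> is not \<open>x\<close>, since
        \<open>insert x I\<close> is dependent, and not in \<open>J\<close>, which lies in
        \<open>I\<close>; so it is \<open>f\<close>. Hence \<open>I\<close> is independent in the
        contraction, and \<open>ext'\<close> applies with \<open>J = I\<close>.\<close>
      then have "insert f I \<in> indeps M" using dep J by auto
      then have "insert x (insert f I) \<in> indeps M" using ext' by blast
      then show False using dep indep_mono[OF M] by blast
    qed
    then show ?thesis using ext'[OF J(1,2)] I' by (auto simp: delete_elem_def)
  next
    case False
    then have "I \<in> indeps (contract_elem M f)" using I' by (simp add: indep_contract_iff[OF M])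
    from ext[OF order_refl this] False show ?thesis
      by (auto simp: indep_contract_iff[OF M] delete_elem_def)
  qed
qed

section \<open>Transfer to \<open>lift_of\<close> along the copy \<open>Some\<close>\<close>

lemma indep_relabel_Some: "Some ` X \<in> indeps (relabel Some M) \<longleftrightarrow> X \<in> indeps M"
  by (simp add: relabel_def inj_image_mem_iff inj_on_def inj_image_eq_iff)

lemma lift_of_ground: "lift_of M N \<Longrightarrow> ground M = ground N"
  unfolding lift_of_def relabel_def delete_elem_def contract_elem_def
  by (auto simp: inj_image_eq_iff)

lemma lift_of_almost_indep:
  assumes "lift_of M N" "X \<in> indeps M"
  obtains x where "X - {x} \<in> indeps N"
proof -
  obtain M' :: "'a option matroid" and f where M': "is_matroid M'"
    and d: "delete_elem M' f = relabel Some M" and c: "contract_elem M' f = relabel Some N"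
    using assms unfolding lift_of_def by blast
  obtain z where z: "Some ` X - {z} \<in> indeps (contract_elem M' f)"
    using delete_indep_almost_contract_indep[OF M', of "Some ` X" f] assms d
    by (auto simp: indep_relabel_Some)
  \<comment> \<open>The removed element \<open>z\<close> lives in the option type, so
    \<open>the z\<close> is its counterpart. If \<open>z\<close> is \<open>None\<close>, nothing is
    removed from the image, and the arbitrary value of \<open>the None\<close> does no harm.\<close>
  have "Some ` (X - {the z}) \<subseteq> Some ` X - {z}" by auto
  then have "Some ` (X - {the z}) \<in> indeps (contract_elem M' f)"
    using z unfolding indep_contract_iff[OF M']
    by (auto split: if_splits intro: indep_mono[OF M'])
  then have "X - {the z} \<in> indeps N" by (simp add: c indep_relabel_Some)
  then show ?thesis using that by blast
qed

lemma lift_of_insert_indep: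
  assumes "lift_of M N" "I \<in> indeps M"
    and ext: "\<And>J. J \<subseteq> I \<Longrightarrow> J \<in> indeps N \<Longrightarrow> insert x J \<in> indeps N"
  shows "insert x I \<in> indeps M"
proof -
  obtain M' :: "'a option matroid" and f where M': "is_matroid M'"
    and d: "delete_elem M' f = relabel Some M" and c: "contract_elem M' f = relabel Some N"
    using assms unfolding lift_of_def by blast
  have "insert (Some x) (Some ` I) \<in> indeps (delete_elem M' f)"
  proof (rule delete_insert_indep[OF M'])
    show "Some ` I \<in> indeps (delete_elem M' f)" using assms d by (simp add: indep_relabel_Some)
    fix J assume J: "J \<subseteq> Some ` I" "J \<in> indeps (contract_elem M' f)"
    then obtain K where "K \<subseteq> I" "J = Some ` K" by (meson subset_imageE)
    then show "insert (Some x) J \<in> indeps (contract_elem M' f)"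
      using ext[of K] J by (simp add: c indep_relabel_Some flip: image_insert)
  qed
  then show ?thesis by (simp add: d indep_relabel_Some flip: image_insert)
qed

text \<open>Removing one element from \<open>X \<union> Y\<close> leaves one of the two disjoint
  sets intact, so the remainder is still dependent in \<open>N\<close>.\<close>

lemma lift_of_disjoint_dependent:
  assumes M: "is_matroid M" and N: "lift_of M N"
    and mono: "\<And>X Y. X \<in> indeps N \<Longrightarrow> Y \<subseteq> X \<Longrightarrow> Y \<in> indeps N"
    and dep: "dependent_in N X" "dependent_in N Y" and disj: "X \<inter> Y = {}"
  shows "dependent_in M (X \<union> Y)"
proof -
  have "X \<union> Y \<notin> indeps M"
  proof
    assume "X \<union> Y \<in> indeps M"
    then obtain z where z: "X \<union> Y - {z} \<in> indeps N" using lift_of_almost_indep[OF N] by blast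
    have "X \<subseteq> X \<union> Y - {z} \<or> Y \<subseteq> X \<union> Y - {z}" using disj by blast
    then show False using z mono dep unfolding dependent_in_def by blast
  qed
  then show ?thesis using dep lift_of_ground[OF N] unfolding dependent_in_def by blast
qed

section \<open>Paths, cycles and forests\<close>

lemma adjacency_path:
  assumes "(u, v) \<in> (adjacency H)\<^sup>*"
  shows "\<exists>vs es. length vs = Suc (length es) \<and> distinct vs \<and> vs ! 0 = u \<and> vs ! length es = v
    \<and> set es \<subseteq> edges H \<and> (\<forall>i<length es. ends H (es ! i) = {vs ! i, vs ! Suc i})"
  using assms
proof (induction rule: converse_rtrancl_induct)
  case base
  show ?case by (rule exI[of _ "[v]"], rule exI[of _ "[]"]) simp
next
  case (step w u)
  obtain e where e: "e \<in> edges H" "ends H e = {w, u}" using step by (auto simp: adjacency_def)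
  obtain vs es where p: "length vs = Suc (length es)" "distinct vs" "vs ! 0 = u"
    "vs ! length es = v" "set es \<subseteq> edges H"
    "\<forall>i<length es. ends H (es ! i) = {vs ! i, vs ! Suc i}"
    using step.IH by blast
  show ?case
  proof (cases "w \<in> set vs")
    case True
    \<comment> \<open>When \<open>w\<close> is already on the path, prepending it would repeat a
      vertex; the tail of the path starting at \<open>w\<close> is used instead.\<close>
    then obtain k where k: "k < length vs" "vs ! k = w" by (auto simp: in_set_conv_nth)
    have "set (drop k es) \<subseteq> edges H" using p set_drop_subset[of k es] by blast
    then show ?thesis using p k
      by (intro exI[of _ "drop k vs"] exI[of _ "drop k es"]) (auto simp: Suc_diff_le)
  next
    case False
    then show ?thesis using p e
      by (intro exI[of _ "w # vs"] exI[of _ "e # es"]) (auto simp: nth_Cons split: nat.splits)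
  qed
qed

text \<open>A path from \<open>u\<close> to \<open>v\<close> inside \<open>X\<close> is closed by
  \<open>e\<close>. The case \<open>u = v\<close> is included: distinctness makes the path trivial,
  and the cycle is the loop-edge \<open>e\<close>.\<close>

lemma cycle_of_path_and_edge:
  assumes G: "finite_graph G" and X: "X \<subseteq> edges G" and uv: "(u, v) \<in> (adjacency (edge_subgraph G X))\<^sup>*"
    and e: "e \<in> edges G" "e \<notin> X" "ends G e = {u, v}"
  shows "\<exists>C. is_cycle G C \<and> edges C \<subseteq> insert e X"
proof -
  obtain vs es where p: "length vs = Suc (length es)" "distinct vs" "vs ! 0 = u"
    "vs ! length es = v" "set es \<subseteq> X"
    "\<And>i. i < length es \<Longrightarrow> ends G (es ! i) = {vs ! i, vs ! Suc i}"
    using adjacency_path[OF uv] by (auto simp: edge_subgraph_def)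
  \<comment> \<open>Edges at different positions of the path are different because consecutive pairs
    in a distinct vertex list are different as sets.\<close>
  have "i = j" if "i < length es" "j < length es" "es ! i = es ! j" for i j
  proof -
    have "{vs ! i, vs ! Suc i} = {vs ! j, vs ! Suc j}" using p(6)[of i] p(6)[of j] that by simp
    then show ?thesis using that p(1) nth_eq_iff_index_eq[OF p(2)] by (auto simp: doubleton_eq_iff)
  qed
  then have dist: "distinct es" by (auto simp: distinct_conv_nth)
  define C where "C = \<lparr>vertices = set vs, edges = insert e (set es), ends = ends G\<rparr>"
  \<comment> \<open>Appending \<open>e\<close> last places it at index \<open>length es\<close>,
    where the successor index wraps around to the start \<open>u\<close> of the path.\<close>
  have cyc: "ends G ((es @ [e]) ! i) = {vs ! i, vs ! (Suc i mod length (es @ [e]))}"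
    if "i < length (es @ [e])" for i
  proof (cases "i < length es")
    case True
    then show ?thesis using p(6) by (simp add: nth_append)
  next
    case False
    then have "i = length es" using that by simp
    then show ?thesis using p(3,4) e(3) by (simp add: insert_commute)
  qed
  have endsC: "ends G d \<subseteq> set vs" if "d \<in> insert e (set es)" for d
  proof -
    have "d \<in> set (es @ [e])" using that by auto
    then obtain i where i: "i < length (es @ [e])" "d = (es @ [e]) ! i" by (metis in_set_conv_nth)
    have "Suc i mod length (es @ [e]) < length vs" using p(1) by simp
    then show ?thesis using cyc[OF i(1)] i p(1) by simp
  qed
  have "set vs \<subseteq> vertices G"
  proof
    fix x assume "x \<in> set vs"
    then obtain i where i: "i < length (es @ [e])" "x = vs ! i" using p(1) by (auto simp: in_set_conv_nth)
    then have "x \<in> ends G ((es @ [e]) ! i)" using cyc[OF i(1)] by simp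
    moreover have "(es @ [e]) ! i \<in> edges G" using nth_mem[OF i(1)] e p(5) X by auto
    ultimately show "x \<in> vertices G" using G unfolding finite_graph_def by blast
  qed
  then have "is_subgraph C G" using endsC e p(5) X by (auto simp: is_subgraph_def C_def)
  moreover have "length vs = length (es @ [e])" "distinct (es @ [e])" using p(1,5) e dist by auto
  ultimately have "is_cycle G C" using cyc p(2) unfolding is_cycle_def
    by (intro conjI exI[of _ vs] exI[of _ "es @ [e]"]) (auto simp: C_def)
  then show ?thesis using p(5) by (intro exI[of _ C]) (auto simp: C_def)
qed

text \<open>Union-find by induction on the edges: \<open>c\<close> names the class of each vertex,
  and equal names certify connection within \<open>X\<close>. Every new edge of a forest merges two
  classes, so the number of names in use on \<open>V\<close> drops by at least one per edge.\<close>

lemma forest_labelling: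
  fixes G :: "('v, 'e) multigraph"
  assumes G: "finite_graph G" and V: "finite V"
    and X: "X \<subseteq> edges G" "\<And>e. e \<in> X \<Longrightarrow> ends G e \<subseteq> V"
    and acyc: "\<nexists>C. is_cycle G C \<and> edges C \<subseteq> X"
  shows "\<exists>c :: 'v \<Rightarrow> 'v. card (c ` V) + card X \<le> card V \<and>
    (\<forall>u v. c u = c v \<longrightarrow> (u, v) \<in> (adjacency (edge_subgraph G X))\<^sup>*)"
proof -
  have "finite X" using G X(1) by (auto simp: finite_graph_def intro: finite_subset)
  then show ?thesis using X acyc
  proof (induction X)
    case empty
    show ?case by (intro exI[of _ "\<lambda>x. x"]) simp
  next
    case (insert e X)
    let ?A = "\<lambda>X. adjacency (edge_subgraph G X)"
    have acyc: "\<nexists>C. is_cycle G C \<and> edges C \<subseteq> X" using insert.prems by blast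
    obtain c :: "'v \<Rightarrow> 'v" where c: "card (c ` V) + card X \<le> card V" "\<And>u v. c u = c v \<Longrightarrow> (u, v) \<in> (?A X)\<^sup>*"
      using insert.IH insert.prems acyc by blast
    have "card (ends G e) = 1 \<or> card (ends G e) = 2"
      using insert.prems G by (auto simp: finite_graph_def)
    then obtain u v where uv: "ends G e = {u, v}"
      by (metis card_1_singletonE card_2_iff insert_absorb2)
    \<comment> \<open>Equal names would give a path from \<open>u\<close> to \<open>v\<close> in
      \<open>X\<close>, which \<open>e\<close> would close to a cycle.\<close>
    have ne: "c u \<noteq> c v"
      using cycle_of_path_and_edge[OF G _ c(2) _ insert.hyps(2) uv] insert.prems by auto
    have uvV: "u \<in> V" "v \<in> V" using insert.prems(2)[of e] uv by auto
    \<comment> \<open>The class of \<open>u\<close> is merged into that of \<open>v\<close>, and the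
      name \<open>c u\<close> disappears.\<close>
    define d where "d = (\<lambda>w. if c w = c u then c v else c w)"
    have "d ` V \<subseteq> c ` V - {c u}" using ne uvV by (auto simp: d_def)
    then have "card (d ` V) \<le> card (c ` V - {c u})" by (intro card_mono) (use V in auto)
    also have "\<dots> < card (c ` V)" using V uvV by (intro card_Diff1_less) auto
    finally have "card (d ` V) + card (insert e X) \<le> card V" using insert.hyps c(1) by simp
    moreover have "(x, y) \<in> (?A (insert e X))\<^sup>*" if xy: "d x = d y" for x y
    proof -
      have sub: "(?A X)\<^sup>* \<subseteq> (?A (insert e X))\<^sup>*"
        by (intro rtrancl_mono) (auto simp: adjacency_def edge_subgraph_def)
      have "(u, v) \<in> ?A (insert e X)" "(v, u) \<in> ?A (insert e X)"
        using uv by (auto simp: adjacency_def edge_subgraph_def)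
      then have uv': "(u, v) \<in> (?A (insert e X))\<^sup>*" "(v, u) \<in> (?A (insert e X))\<^sup>*" by auto
      have c': "(a, b) \<in> (?A (insert e X))\<^sup>*" if "c a = c b" for a b using c(2)[OF that] sub by blast
      consider "c x = c y" | "c x = c u" "c v = c y" | "c x = c v" "c u = c y"
        using xy by (auto simp: d_def split: if_splits)
      then show ?thesis
        using c' uv' by cases (meson rtrancl_trans)+
    qed
    ultimately show ?case by blast
  qed
qed

lemma forest_card_less:
  assumes "finite_graph G" "finite V" "V \<noteq> {}" "X \<subseteq> edges G" "\<And>e. e \<in> X \<Longrightarrow> ends G e \<subseteq> V"
    "\<nexists>C. is_cycle G C \<and> edges C \<subseteq> X"
  shows "card X < card V"
proof -
  obtain c :: "'a \<Rightarrow> 'a" where "card (c ` V) + card X \<le> card V"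
    using forest_labelling[of G V X] assms by metis
  moreover have "card (c ` V) > 0" using assms by (simp add: card_gt_0_iff)
  ultimately show ?thesis by linarith
qed

section \<open>Edges and vertices of a cycle\<close>

lemma cycle_edges_subset: "is_cycle G C \<Longrightarrow> edges C \<subseteq> edges G"
  unfolding is_cycle_def is_subgraph_def by blast

lemma cycle_ends_subset: "is_cycle G C \<Longrightarrow> e \<in> edges C \<Longrightarrow> ends G e \<subseteq> vertices C"
  unfolding is_cycle_def is_subgraph_def by (elim conjE) simp

text \<open>A non-loop edge forces length at least two, and then each vertex lies on two cyclically
  consecutive edges. If \<open>v\<close> is the first end of edge number \<open>i\<close>, the other
  edge is the predecessor; otherwise it is the successor.\<close>

lemma cycle_second_edge:
  assumes C: "is_cycle G C" and e: "e \<in> edges C" "v \<in> ends G e" "ends G e \<noteq> {v}"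
  shows "\<exists>d\<in>edges C. d \<noteq> e \<and> v \<in> ends G d"
proof -
  obtain vs es where c: "length vs = length es" "distinct es" "edges C = set es"
    "\<And>i. i < length es \<Longrightarrow> ends G (es ! i) = {vs ! i, vs ! (Suc i mod length es)}"
    using C unfolding is_cycle_def is_subgraph_def by auto
  define n where "n = length es"
  obtain i where i: "i < n" "e = es ! i" using e(1) c(3) unfolding n_def by (auto simp: in_set_conv_nth)
  have ends_e: "ends G e = {vs ! i, vs ! (Suc i mod n)}" using c(4) i n_def by simp
  have n: "1 < n"
  proof (rule ccontr)
    assume "\<not> 1 < n"
    then have "i = 0" "n = 1" using i by auto
    then show False using ends_e e by auto
  qed
  have "\<exists>j<n. j \<noteq> i \<and> v \<in> ends G (es ! j)"
  proof (cases "v = vs ! i")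
    case True
    show ?thesis
    proof (cases i)
      case 0
      \<comment> \<open>The predecessor of index \<open>0\<close> is \<open>n - 1\<close>, the edge
        that closes the cycle.\<close>
      have "Suc (n - 1) mod n = 0" using n by simp
      then show ?thesis using True 0 n c(4)[of "n - 1"] n_def by (intro exI[of _ "n - 1"]) auto
    next
      case (Suc k)
      then show ?thesis using True i c(4)[of k] n_def by (intro exI[of _ k]) auto
    qed
  next
    case False
    then have v: "v = vs ! (Suc i mod n)" using e ends_e by auto
    have "Suc i mod n < n" using n by simp
    moreover have "Suc i mod n \<noteq> i" using v False by metis
    ultimately show ?thesis using v c(4)[of "Suc i mod n"] n_def by (intro exI[of _ "Suc i mod n"]) auto
  qed
  then show ?thesis using i c(2,3) n_def by (metis nth_eq_iff_index_eq nth_mem)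
qed

lemma adjacency_rtrancl_sym: "(u, v) \<in> (adjacency H)\<^sup>* \<Longrightarrow> (v, u) \<in> (adjacency H)\<^sup>*"
  by (rule symD[OF sym_rtrancl]) (auto simp: sym_def adjacency_def insert_commute)

lemma cycle_connected:
  assumes C: "is_cycle G C"
  shows "connected_graph C"
proof -
  obtain vs es where c: "es \<noteq> []" "length vs = length es" "vertices C = set vs" "edges C = set es"
    "\<And>i. i < length es \<Longrightarrow> ends C (es ! i) = {vs ! i, vs ! (Suc i mod length es)}"
    using C unfolding is_cycle_def by auto
  have "(vs ! 0, vs ! i) \<in> (adjacency C)\<^sup>*" if "i < length es" for i
    using that
  proof (induction i)
    case (Suc i)
    then have "(vs ! i, vs ! Suc i) \<in> adjacency C"
      using c(4) c(5)[of i] by (auto simp: adjacency_def intro!: bexI[of _ "es ! i"])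
    then show ?case using Suc by (meson Suc_lessD rtrancl.rtrancl_into_rtrancl)
  qed simp
  then have "(vs ! 0, x) \<in> (adjacency C)\<^sup>*" if "x \<in> vertices C" for x
    using that c by (auto simp: in_set_conv_nth)
  then have "(x, y) \<in> (adjacency C)\<^sup>*" if "x \<in> vertices C" "y \<in> vertices C" for x y
    using that adjacency_rtrancl_sym by (meson rtrancl_trans)
  then show ?thesis using c by (auto simp: connected_graph_def)
qed

lemma cycle_vertex_in_edge:
  assumes "is_cycle G C" "x \<in> vertices C"
  shows "\<exists>e\<in>edges C. x \<in> ends G e"
proof -
  obtain vs es where c: "length vs = length es" "vertices C = set vs" "edges C = set es"
    "\<And>i. i < length es \<Longrightarrow> ends G (es ! i) = {vs ! i, vs ! (Suc i mod length es)}"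
    using assms(1) unfolding is_cycle_def is_subgraph_def by auto
  obtain i where "i < length es" "x = vs ! i" using assms(2) c by (auto simp: in_set_conv_nth)
  then show ?thesis using c(3) c(4)[of i] by (intro bexI[of _ "es ! i"]) auto
qed

lemma cycle_edges_nonempty: "is_cycle G C \<Longrightarrow> edges C \<noteq> {}"
  unfolding is_cycle_def by auto

lemma cycle_subgraph_edge_subgraph:
  assumes "is_cycle G C" "edges C \<subseteq> X"
  shows "is_subgraph C (edge_subgraph G X)"
proof -
  have "ends C = ends G" using assms(1) unfolding is_cycle_def is_subgraph_def by blast
  moreover have "\<And>e. e \<in> edges C \<Longrightarrow> ends G e \<subseteq> vertices C"
    using cycle_ends_subset[OF assms(1)] .
  moreover have "vertices C \<subseteq> (\<Union>e\<in>X. ends G e)"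
    using assms(2) cycle_vertex_in_edge[OF assms(1)] by blast
  ultimately show ?thesis using assms(2) by (simp add: is_subgraph_def edge_subgraph_def)
qed

text \<open>A common edge would have its ends, of which there is at least one, in both vertex
  sets.\<close>

lemma disjoint_cycles_disjoint_edges:
  assumes G: "finite_graph G" and C: "is_cycle G C" "is_cycle G D" "vertices C \<inter> vertices D = {}"
  shows "edges C \<inter> edges D = {}"
proof -
  have "ends G e \<subseteq> vertices C \<inter> vertices D" if "e \<in> edges C \<inter> edges D" for e
    using that cycle_ends_subset[OF C(1)] cycle_ends_subset[OF C(2)] by blast
  moreover have "ends G e \<noteq> {}" if "e \<in> edges C" for e
  proof -
    have "card (ends G e) = 1 \<or> card (ends G e) = 2"
      using that G cycle_edges_subset[OF C(1)] unfolding finite_graph_def by blast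
    then show ?thesis by auto
  qed
  ultimately show ?thesis using C by blast
qed

section \<open>Components\<close>

text \<open>The union of two connected subgraphs sharing \<open>w\<close> is connected, since every
  vertex is reached from \<open>w\<close>; maximality of \<open>K\<close> makes the union equal to
  \<open>K\<close>.\<close>

lemma component_absorbs:
  assumes K: "K \<in> components G" and H: "is_subgraph H G" "connected_graph H"
    and w: "w \<in> vertices K" "w \<in> vertices H"
  shows "is_subgraph H K"
proof -
  let ?U = "graph_union K H"
  have K': "is_subgraph K G" "connected_graph K" using K by (auto simp: components_def)
  have ends: "ends K = ends G" "ends H = ends G" using K' H by (auto simp: is_subgraph_def)
  have sub: "is_subgraph ?U G" "is_subgraph K ?U" "is_subgraph H ?U"
    using K'(1) H(1) ends unfolding is_subgraph_def graph_union_def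
    by (simp_all add: Ball_def subset_iff)
  have "(adjacency K)\<^sup>* \<subseteq> (adjacency ?U)\<^sup>*" "(adjacency H)\<^sup>* \<subseteq> (adjacency ?U)\<^sup>*"
    using ends by (intro rtrancl_mono; auto simp: adjacency_def graph_union_def)+
  moreover have "(w, x) \<in> (adjacency K)\<^sup>* \<union> (adjacency H)\<^sup>*" if "x \<in> vertices ?U" for x
    using that w K'(2) H(2) by (auto simp: graph_union_def connected_graph_def)
  ultimately have "(w, x) \<in> (adjacency ?U)\<^sup>*" if "x \<in> vertices ?U" for x
    using that by blast
  then have "(x, y) \<in> (adjacency ?U)\<^sup>*" if "x \<in> vertices ?U" "y \<in> vertices ?U" for x y
    using that adjacency_rtrancl_sym by (meson rtrancl_trans)
  then have "connected_graph ?U" using w by (auto simp: connected_graph_def graph_union_def)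
  then have "?U = K" using K sub by (auto simp: components_def)
  then show ?thesis using sub(3) by simp
qed

lemma components_disjoint:
  assumes "H \<in> components G" "K \<in> components G" "H \<noteq> K"
  shows "vertices H \<inter> vertices K = {}"
proof (rule ccontr)
  assume "\<not> ?thesis"
  then obtain w where w: "w \<in> vertices H" "w \<in> vertices K" by blast
  have "is_subgraph H G" "connected_graph H" "is_subgraph K G" "connected_graph K"
    using assms(1,2) by (simp_all add: components_def)
  then have "is_subgraph H K" "is_subgraph K H"
    using component_absorbs[OF assms(1) _ _ w] component_absorbs[OF assms(2) _ _ w(2,1)] by blast+
  \<comment> \<open>Mutual subgraphs agree as records because a subgraph keeps the whole function
    \<open>ends\<close>.\<close>
  then have "H = K" unfolding is_subgraph_def by (intro multigraph.equality) auto
  then show False using assms by simp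
qed

text \<open>An edge-induced subgraph has no isolated vertices, so a vertex of \<open>K\<close> lies
  on an edge of \<open>X\<close> and thus on a cycle within \<open>X\<close>. Being connected, that
  cycle is absorbed by \<open>K\<close>.\<close>

lemma cycle_in_component:
  assumes K: "K \<in> components (edge_subgraph G X)"
    and cyc: "\<And>e. e \<in> X \<Longrightarrow> \<exists>D. is_cycle G D \<and> e \<in> edges D \<and> edges D \<subseteq> X"
  shows "\<exists>D. is_cycle G D \<and> edges D \<subseteq> X \<and> is_subgraph D K"
proof -
  obtain w where w: "w \<in> vertices K"
    using K by (auto simp: components_def connected_graph_def)
  moreover have "vertices K \<subseteq> (\<Union>e\<in>X. ends G e)"
    using K by (auto simp: components_def is_subgraph_def edge_subgraph_def)
  ultimately obtain e where e: "e \<in> X" "w \<in> ends G e" by blast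
  obtain D where D: "is_cycle G D" "e \<in> edges D" "edges D \<subseteq> X" using cyc[OF e(1)] by blast
  have "w \<in> vertices D" using cycle_ends_subset[OF D(1,2)] e(2) by blast
  then show ?thesis
    using component_absorbs[OF K cycle_subgraph_edge_subgraph[OF D(1,3)] cycle_connected[OF D(1)] w] D
    by blast
qed

section \<open>The framework axioms\<close>

lemma three_distinct_elements:
  assumes "card A > 2"
  obtains x y z where "x \<in> A" "y \<in> A" "z \<in> A" "x \<noteq> y" "x \<noteq> z" "y \<noteq> z"
proof -
  obtain T where "T \<subseteq> A" "card T = 3"
    using obtain_subset_with_card_n[of 3 A] assms by auto
  then show ?thesis using that by (auto simp: card_3_iff)
qed

section \<open>Bounds for rank and closure\<close>

lemma rank_le:
  assumes "is_matroid M" "\<And>Y. Y \<in> indeps M \<Longrightarrow> Y \<subseteq> X \<Longrightarrow> card Y \<le> n"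
  shows "matroid_rank M X \<le> n"
proof -
  have "finite (indeps M)"
    using assms(1) by (auto simp: is_matroid_def intro: finite_subset[of _ "Pow (ground M)"])
  then show ?thesis using assms indep_empty[OF assms(1)] unfolding matroid_rank_def
    by (subst Max_le_iff) auto
qed

lemma card_le_rank:
  assumes "is_matroid M" "Y \<in> indeps M" "Y \<subseteq> X"
  shows "card Y \<le> matroid_rank M X"
proof -
  have "finite (indeps M)"
    using assms(1) by (auto simp: is_matroid_def intro: finite_subset[of _ "Pow (ground M)"])
  then show ?thesis using assms unfolding matroid_rank_def by (intro Max_ge) auto
qed

text \<open>If every independent subset of \<open>F\<close> can be extended by \<open>x\<close>,
  then so can one of maximum size, and adding \<open>x\<close> raises the rank.\<close>

lemma not_in_closure:
  assumes M: "is_matroid M" and x: "x \<notin> F"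
    and ext: "\<And>I. I \<in> indeps M \<Longrightarrow> I \<subseteq> F \<Longrightarrow> insert x I \<in> indeps M"
  shows "x \<notin> matroid_closure M F"
proof -
  have "Suc (matroid_rank M F) \<le> matroid_rank M (insert x F)"
  proof -
    have "card I \<le> matroid_rank M (insert x F) - 1" if I: "I \<in> indeps M" "I \<subseteq> F" for I
    proof -
      have "card (insert x I) = Suc (card I)"
        using finite_indep[OF M I(1)] I(2) x by (subst card_insert_disjoint) auto
      then show ?thesis
        using card_le_rank[OF M ext[OF I], of "insert x F"] I by fastforce
    qed
    then have "matroid_rank M F \<le> matroid_rank M (insert x F) - 1" by (rule rank_le[OF M])
    \<comment> \<open>The bound above uses truncated subtraction; the independent set
      \<open>{x}\<close> makes the rank positive, so the \<open>1\<close> can be moved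
      across.\<close>
    moreover have "card {x} \<le> matroid_rank M (insert x F)"
      using ext[of "{}"] indep_empty[OF M] by (intro card_le_rank[OF M]) auto
    ultimately show ?thesis by simp
  qed
  then show ?thesis by (simp add: matroid_closure_def)
qed

section \<open>The axioms for a lift of the cycle matroid\<close>

lemma cycle_dependent: "is_cycle G C \<Longrightarrow> dependent_in (cycle_matroid G) (edges C)"
  using cycle_edges_subset[of G C] by (auto simp: dependent_in_def cycle_matroid_def)

lemma component_rank_le:
  assumes G: "finite_graph G" and M: "is_matroid M" and lift: "lift_of M (cycle_matroid G)"
    and H: "H \<in> components G"
  shows "matroid_rank M (edges H) \<le> card (vertices H)"
proof (rule rank_le[OF M])
  fix Y assume Y: "Y \<in> indeps M" "Y \<subseteq> edges H"
  have sub: "is_subgraph H G" and ne: "vertices H \<noteq> {}"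
    using H by (auto simp: components_def connected_graph_def)
  then have fin: "finite (vertices H)"
    using G by (auto simp: is_subgraph_def finite_graph_def intro: finite_subset)
  obtain x where x: "Y - {x} \<in> indeps (cycle_matroid G)" using lift_of_almost_indep[OF lift Y(1)] .
  have "ends G e \<subseteq> vertices H" if "e \<in> Y - {x}" for e
    using that Y sub unfolding is_subgraph_def by (metis DiffD1 subsetD)
  then have "card (Y - {x}) < card (vertices H)"
    using x by (intro forest_card_less[OF G fin ne]) (simp_all add: cycle_matroid_def)
  \<comment> \<open>The strict forest bound leaves room to put the removed element \<open>x\<close>
    back.\<close>
  then show "card Y \<le> card (vertices H)"
    using finite_indep[OF M Y(1)] by (cases "x \<in> Y") auto
qed

lemma closure_delete_vertex:
  assumes M: "is_matroid M" and lift: "lift_of M (cycle_matroid G)"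
  shows "matroid_closure M (edges (delete_vertex G v)) \<subseteq> edges (delete_vertex G v) \<union> loops_at G v"
proof (rule subsetI, rule ccontr)
  let ?F = "edges (delete_vertex G v)"
  fix e assume e: "e \<in> matroid_closure M ?F" "e \<notin> ?F \<union> loops_at G v"
  have eG: "e \<in> edges G" using e(1) lift_of_ground[OF lift]
    by (auto simp: matroid_closure_def cycle_matroid_def)
  then have ends: "v \<in> ends G e" "ends G e \<noteq> {v}"
    using e(2) by (auto simp: delete_vertex_def loops_at_def)
  have "insert e J \<in> indeps (cycle_matroid G)"
    if J: "J \<subseteq> ?F" "J \<in> indeps (cycle_matroid G)" for J
  proof -
    have "False" if C: "is_cycle G C" "edges C \<subseteq> insert e J" for C
    proof -
      \<comment> \<open>The cycle must use \<open>e\<close> because \<open>J\<close> is acyclic; its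
        second edge at \<open>v\<close> would then belong to \<open>J\<close>, whose edges avoid
        \<open>v\<close>.\<close>
      have "e \<in> edges C" using C J by (auto simp: cycle_matroid_def)
      then obtain d where "d \<in> edges C" "d \<noteq> e" "v \<in> ends G d"
        using cycle_second_edge[OF C(1) _ ends] by blast
      then show False using C J by (auto simp: delete_vertex_def)
    qed
    then show ?thesis using J eG by (auto simp: cycle_matroid_def)
  qed
  then have "insert e I \<in> indeps M" if "I \<in> indeps M" "I \<subseteq> ?F" for I
    using lift_of_insert_indep[OF lift that(1)] that by (meson subset_trans)
  then show False using not_in_closure[OF M] e by blast
qed

lemma circuit_edge_in_cycle:
  assumes lift: "lift_of M (cycle_matroid G)" and C: "circuit M C" and e: "e \<in> C"
  shows "\<exists>D. is_cycle G D \<and> e \<in> edges D \<and> edges D \<subseteq> C"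
proof -
  have CM: "C \<subseteq> ground M" "C \<notin> indeps M"
    using C unfolding circuit_def dependent_in_def by blast+
  have "C - {e} \<subset> C" using e by blast
  then have "\<not> dependent_in M (C - {e})" using C unfolding circuit_def by blast
  then have I: "C - {e} \<in> indeps M" using CM(1) unfolding dependent_in_def by blast
  have "insert e (C - {e}) = C" using e by blast
  \<comment> \<open>By minimality \<open>C - {e}\<close> is independent, yet adding \<open>e\<close>
    gives the dependent set \<open>C\<close>. So the extension property must fail for some
    \<open>J\<close>, and this failure produces a cycle through \<open>e\<close>.\<close>
  then obtain J where J: "J \<subseteq> C - {e}" "J \<in> indeps (cycle_matroid G)"
    "insert e J \<notin> indeps (cycle_matroid G)"
    using lift_of_insert_indep[OF lift I, of e] CM(2) by metis
  have "e \<in> edges G" using CM e lift_of_ground[OF lift] by (auto simp: cycle_matroid_def)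
  then obtain D where "is_cycle G D" "edges D \<subseteq> insert e J" "\<not> edges D \<subseteq> J"
    using J(2,3) by (auto simp: cycle_matroid_def)
  then show ?thesis using J(1) e by (intro exI[of _ D]) auto
qed

lemma disjoint_cycles_dependent:
  assumes "finite_graph G" "is_matroid M" "lift_of M (cycle_matroid G)"
    and "is_cycle G C" "is_cycle G D" "vertices C \<inter> vertices D = {}"
  shows "dependent_in M (edges C \<union> edges D)"
proof (rule lift_of_disjoint_dependent[OF assms(2,3) _ cycle_dependent[OF assms(4)]
      cycle_dependent[OF assms(5)] disjoint_cycles_disjoint_edges[OF assms(1,4,5,6)]])
  fix X Y assume "X \<in> indeps (cycle_matroid G)" "Y \<subseteq> X"
  then show "Y \<in> indeps (cycle_matroid G)"
    unfolding cycle_matroid_def by (simp, meson subset_trans)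
qed

lemma circuit_components_le_2:
  assumes G: "finite_graph G" and M: "is_matroid M" and lift: "lift_of M (cycle_matroid G)"
    and C: "circuit M C"
  shows "card (components (edge_subgraph G C)) \<le> 2"
proof (rule ccontr)
  let ?K = "components (edge_subgraph G C)"
  assume "\<not> ?thesis"
  then obtain K1 K2 K3 where K: "K1 \<in> ?K" "K2 \<in> ?K" "K3 \<in> ?K" "K1 \<noteq> K2" "K1 \<noteq> K3" "K2 \<noteq> K3"
    using three_distinct_elements[of ?K] by (metis not_le)
  have "\<exists>D. is_cycle G D \<and> edges D \<subseteq> C \<and> is_subgraph D K" if "K \<in> ?K" for K
    using cycle_in_component[OF that circuit_edge_in_cycle[OF lift C]] .
  then obtain D1 D2 D3 where D: "is_cycle G D1" "edges D1 \<subseteq> C" "is_subgraph D1 K1"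
    "is_cycle G D2" "edges D2 \<subseteq> C" "is_subgraph D2 K2"
    "is_cycle G D3" "edges D3 \<subseteq> C" "is_subgraph D3 K3"
    using K(1-3) by metis
  have disj: "vertices D1 \<inter> vertices D2 = {}" "vertices D1 \<inter> vertices D3 = {}"
    "vertices D2 \<inter> vertices D3 = {}"
    using components_disjoint[OF K(1,2,4)] components_disjoint[OF K(1,3,5)]
      components_disjoint[OF K(2,3,6)] D unfolding is_subgraph_def by blast+
  \<comment> \<open>The third cycle makes the inclusion proper: its edges are nonempty, lie in
    \<open>C\<close> and avoid the other two cycles. A dependent proper subset contradicts the
    minimality of the circuit.\<close>
  have "edges D1 \<union> edges D2 \<subset> C"
    using disjoint_cycles_disjoint_edges[OF G D(1,7) disj(2)]
      disjoint_cycles_disjoint_edges[OF G D(4,7) disj(3)] cycle_edges_nonempty[OF D(7)] D by blast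
  then show False
    using C disjoint_cycles_dependent[OF G M lift D(1,4) disj(1)] unfolding circuit_def by blast
qed

theorem theorem6p1:
  fixes G :: "('v, 'e) multigraph" and M :: "'e matroid"
  assumes "finite_graph G" and "is_matroid M" and "lift_of M (cycle_matroid G)"
  shows "is_framework G M \<and>
    (\<forall>C1 C2. is_cycle G C1 \<and> is_cycle G C2 \<and> vertices C1 \<inter> vertices C2 = {} \<longrightarrow>
       dependent_in M (edges (graph_union C1 C2)))"
proof -
  have "edges G = ground M"
    using lift_of_ground[OF assms(3)] by (simp add: cycle_matroid_def)
  then have "is_framework G M"
    using component_rank_le[OF assms] closure_delete_vertex[OF assms(2,3)]
      circuit_components_le_2[OF assms] unfolding is_framework_def by blast
  then show ?thesis
    using disjoint_cycles_dependent[OF assms] by (simp add: graph_union_def)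
qed

end
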